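(* Let $A\in\mathbb{S}^n_+\setminus\{O\}$, $B\in\mathbb{S}^n\setminus\{O\}$ and $E=\{A+tB:t\in\mathbb{R}\}$. If $\mathbb{S}^n_+\cap E=\{A\}$ and the singularity degree of $E\cap\mathbb{S}^n_+$ is greater than $1$, then there exists an initial point $U_0\in E$ such that the sequence defined by $U_{k+1}=P_E(P_{\mathbb{S}^n_+}(U_k))$, $k=0,1,2,\ldots$, satisfies $\|U_k-A\|=\Theta(k^{-1/2})$ as $k\to\infty$.
   Context: $\mathbb{S}^n$ is the space of real symmetric $n\times n$ matrices with inner product $\langle U,V\rangle=\operatorname{tr}(UV)$ and Frobenius norm $\|U\|=\sqrt{\langle U,U\rangle}$; $\mathbb{S}^n_+$ is the cone of positive semidefinite matrices in $\mathbb{S}^n$. For a closed convex set $H\subset\mathbb{S}^n$, $P_H(U)=\operatorname{argmin}_{X\in H}\|X-U\|$. For $F\subset\mathbb{S}^n$, $F^\perp=\{V\in\mathbb{S}^n:\langle V,X\rangle=0\ \text{for all }X\in F\}$. Singularity degree. Let $E'=\{X\in\mathbb{S}^n:\langle C_k,X\rangle=b_k,\ k=1,\ldots,p\}$ be an affine subspace, where $C_k\in\mathbb{S}^n$ and $b=(b_1,\ldots,b_p)^T\in\mathbb{R}^p$, such that $E'\cap\mathbb{S}^n_+\neq\emptyset$ and $E'$ does not meet the interior of $\mathbb{S}^n_+$. The minimal face $F_{\min}$ of $E'\cap\mathbb{S}^n_+$ is the intersection of all faces of $\mathbb{S}^n_+$ containing $E'\cap\mathbb{S}^n_+$. A facial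 reduction sequence is a sequence of faces $\mathbb{S}^n_+=F_0,F_1,\ldots,F_s=F_{\min}$ such that for each $i=1,\ldots,s$ there exist $y\in\mathbb{R}^p$, $U^i\in\mathbb{S}^n_+$ and $V\in F_{i-1}^\perp$ with $b^Ty=0$, $\sum_{k=1}^p y_kC_k=U^i+V\notin F_{i-1}^\perp$, and $F_i=F_{i-1}\cap\{U^i\}^\perp$. The singularity degree of $E'\cap\mathbb{S}^n_+$ is the minimum length $s$ of such sequences. *)

theory Defs
  imports "HOL-Analysis.Analysis" "HOL-Library.Landau_Symbols"
begin

(* The library's inner product and norm on real^'n^'n are entrywise. On symmetric matrices they
   are the trace inner product and the Frobenius norm; see inner_sym_eq_trace. *)

definition sym_matrices :: "(real^'n^'n) set" where
  "sym_matrices = {X. transpose X = X}"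

definition psd_cone :: "(real^'n^'n) set" where
  "psd_cone = {X \<in> sym_matrices. \<forall>x. 0 \<le> x \<bullet> (X *v x)}"

lemma inner_sym_eq_trace:
  fixes U V :: "real^'n^'n"
  assumes "U \<in> sym_matrices"
  shows "U \<bullet> V = trace (U ** V)"
proof -
  have U: "U $ i $ j = U $ j $ i" for i j
  proof -
    have "transpose U $ i $ j = U $ j $ i"
      by (simp add: transpose_def)
    then show ?thesis
      using assms by (simp add: sym_matrices_def)
  qed
  have "U \<bullet> V = (\<Sum>i\<in>UNIV. \<Sum>j\<in>UNIV. U $ i $ j * V $ i $ j)"
    by (simp add: inner_vec_def)
  also have "\<dots> = (\<Sum>i\<in>UNIV. \<Sum>j\<in>UNIV. U $ j $ i * V $ i $ j)"
    by (subst U) (rule refl)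
  also have "\<dots> = (\<Sum>j\<in>UNIV. \<Sum>i\<in>UNIV. U $ j $ i * V $ i $ j)"
    by (rule sum.swap)
  also have "\<dots> = trace (U ** V)"
    by (simp add: trace_def matrix_matrix_mult_def)
  finally show ?thesis .
qed

(* Taken within the symmetric matrices: orthogonal_comp would add all skew-symmetric ones. *)
definition sym_perp :: "(real^'n^'n) set \<Rightarrow> (real^'n^'n) set" where
  "sym_perp F = {V \<in> sym_matrices. \<forall>X\<in>F. V \<bullet> X = 0}"

definition affine_space :: "nat \<Rightarrow> (nat \<Rightarrow> real^'n^'n) \<Rightarrow> (nat \<Rightarrow> real) \<Rightarrow> (real^'n^'n) set" where
  "affine_space p C b = {X \<in> sym_matrices. \<forall>k\<in>{1..p}. C k \<bullet> X = b k}"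

definition minimal_face :: "(real^'n^'n) set \<Rightarrow> (real^'n^'n) set" where
  "minimal_face E = \<Inter>{F. F face_of psd_cone \<and> E \<inter> psd_cone \<subseteq> F}"

(* The sequence is F 0, ..., F s; the values of F beyond s are irrelevant. *)
definition facial_reduction_sequence ::
  "nat \<Rightarrow> (nat \<Rightarrow> real^'n^'n) \<Rightarrow> (nat \<Rightarrow> real) \<Rightarrow> nat \<Rightarrow> (nat \<Rightarrow> (real^'n^'n) set) \<Rightarrow> bool" where
  "facial_reduction_sequence p C b s F \<longleftrightarrow>
     F 0 = psd_cone \<and> F s = minimal_face (affine_space p C b) \<and>
     (\<forall>i\<le>s. F i face_of psd_cone) \<and>
     (\<forall>i\<in>{1..s}. \<exists>y U V.
        U \<in> psd_cone \<and> V \<in> sym_perp (F (i - 1)) \<and>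
        (\<Sum>k=1..p. b k * y k) = 0 \<and>
        (\<Sum>k=1..p. y k *\<^sub>R C k) = U + V \<and>
        U + V \<notin> sym_perp (F (i - 1)) \<and>
        F i = F (i - 1) \<inter> sym_perp {U})"

(* Meant for symmetric C k with affine_space p C b meeting the cone but not its interior (relative
   to the symmetric matrices). A facial reduction sequence then exists, so the set of lengths is
   nonempty, and the value depends only on the affine space, not on p, C and b. *)
definition singularity_degree :: "nat \<Rightarrow> (nat \<Rightarrow> real^'n^'n) \<Rightarrow> (nat \<Rightarrow> real) \<Rightarrow> nat" where
  "singularity_degree p C b = (LEAST s. \<exists>F. facial_reduction_sequence p C b s F)"

primrec alternating_projections ::
  "(real^'n^'n) set \<Rightarrow> real^'n^'n \<Rightarrow> nat \<Rightarrow> real^'n^'n" where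
  "alternating_projections E U0 0 = U0"
| "alternating_projections E U0 (Suc k) =
     closest_point E (closest_point psd_cone (alternating_projections E U0 k))"

end

theory Submission
  imports Defs
begin

text \<open>
  Let \<open>K\<close> be the kernel of \<open>A\<close>. If \<open>B\<close> took both signs on \<open>K\<close>, then a positive
  semidefinite \<open>U\<close> that is positive definite on \<open>K\<close>, zero on its orthogonal complement and
  orthogonal to \<open>B\<close> would exist, and \<open>U\<close> alone would expose the minimal face: facial reduction
  would end after one step. So a singularity degree greater than one makes \<open>B\<close> semidefinite on
  \<open>K\<close>, and replacing \<open>B\<close> by \<open>- B\<close> makes it positive semidefinite there
  (\<open>singularity_degree_gt_1_imp_semidefinite_on_kernel\<close>). As the points \<open>A + t B\<close> with \<open>t > 0\<close>
  nevertheless lie outside the cone, some \<open>v\<close> in \<open>K\<close> satisfies \<open>v \<bullet> B v = 0\<close> but \<open>B v \<noteq> 0\<close>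
  (\<open>degenerate_kernel_direction\<close>).

  For small \<open>t > 0\<close> let \<open>P\<close> be the projection of \<open>A + t B\<close> onto the cone and
  \<open>N = P - (A + t B)\<close>. Orthogonality of \<open>N\<close> and \<open>P\<close> gives
  \<open>t (N \<bullet> B) = - (\<parallel>N\<parallel>\<^sup>2 + N \<bullet> A)\<close>, so one alternating projection moves the parameter from \<open>t\<close> to
  \<open>t - (\<parallel>N\<parallel>\<^sup>2 + N \<bullet> A) / (t \<parallel>B\<parallel>\<^sup>2)\<close>. The numerator has exact order \<open>t ^ 4\<close>. From below, the
  quadratic form of \<open>A + t B\<close> at \<open>v + t y\<close> is at most a negative multiple of \<open>t\<^sup>2\<close> for a
  suitable \<open>y\<close>, which forces \<open>\<parallel>N\<parallel>\<close> to be at least of that order (\<open>residual_lower_bound\<close>). From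
  above, \<open>A / 2 + t B + c t\<^sup>2 I\<close> is positive semidefinite for some \<open>c\<close>, and pairing it with \<open>N\<close>
  bounds \<open>\<parallel>N\<parallel>\<^sup>2\<close> and \<open>N \<bullet> A\<close> together (\<open>residual_energy_upper_bound\<close>).

  The parameters therefore decrease by an amount of order \<open>t ^ 3\<close> in each step, so that \<open>1 / t\<^sup>2\<close>
  grows linearly and \<open>t\<close> decays like \<open>k powr (-1/2)\<close> (\<open>cubic_decrement_bigtheta\<close>).
\<close>

section \<open>Quadratic forms\<close>

definition quad :: "real^'n^'n \<Rightarrow> real^'n \<Rightarrow> real" where
  "quad X v = v \<bullet> (X *v v)"

lemma quad_add: "quad (X + Y) v = quad X v + quad Y v"
  by (simp add: quad_def matrix_vector_mult_add_rdistrib inner_add_right)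

lemma quad_scaleR: "quad (c *\<^sub>R X) v = c * quad X v"
  by (simp add: quad_def scaleR_matrix_vector_assoc[symmetric])

lemma quad_mat_1: "quad (mat 1) v = (norm v)\<^sup>2"
  by (simp add: quad_def power2_norm_eq_inner)

lemma quad_scaleR_arg: "quad X (c *\<^sub>R v) = c\<^sup>2 * quad X v"
  by (simp add: quad_def matrix_vector_mult_scaleR power2_eq_square)

lemma subspace_sym_matrices: "subspace sym_matrices"
  by (auto simp: subspace_def sym_matrices_def transpose_def vec_eq_iff)

lemma mat_1_sym: "mat 1 \<in> sym_matrices"
  by (simp add: sym_matrices_def transpose_mat)

lemma inner_sym_swap:
  assumes "X \<in> sym_matrices"
  shows "u \<bullet> (X *v v) = v \<bullet> (X *v u)"
  using assms dot_lmul_matrix[of u X v] transpose_matrix_vector[of X u]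
  by (simp add: sym_matrices_def inner_commute)

lemma quad_add_arg:
  assumes "X \<in> sym_matrices"
  shows "quad X (u + v) = quad X u + 2 * (u \<bullet> (X *v v)) + quad X v"
  using inner_sym_swap[OF assms, of u v]
  by (simp add: quad_def matrix_vector_right_distrib inner_add_left inner_add_right)

lemma quad_add_kernel:
  assumes "X \<in> sym_matrices" "X *v v = 0"
  shows "quad X (u + v) = quad X u"
  using assms by (simp add: quad_add_arg) (simp add: quad_def)

lemma psd_cone_iff: "X \<in> psd_cone \<longleftrightarrow> X \<in> sym_matrices \<and> (\<forall>v. 0 \<le> quad X v)"
  by (simp add: psd_cone_def quad_def)

lemma bilinear_bound:
  fixes X :: "real^'n^'n"
  obtains \<beta> :: real where "\<beta> > 0" "\<And>u v. \<bar>u \<bullet> (X *v v)\<bar> \<le> \<beta> * norm u * norm v"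
proof -
  have bl: "bounded_linear ((*v) X)"
    by (rule matrix_vector_mul_bounded_linear)
  then obtain \<beta> where \<beta>: "\<beta> > 0" "\<And>v. norm (X *v v) \<le> norm v * \<beta>"
    using bounded_linear.pos_bounded by blast
  have "\<bar>u \<bullet> (X *v v)\<bar> \<le> \<beta> * norm u * norm v" for u v
  proof -
    have "\<bar>u \<bullet> (X *v v)\<bar> \<le> norm u * norm (X *v v)"
      by (rule Cauchy_Schwarz_ineq2)
    also have "\<dots> \<le> norm u * (norm v * \<beta>)"
      using \<beta> by (intro mult_left_mono) auto
    finally show ?thesis by (simp add: mult_ac)
  qed
  with \<beta>(1) that show thesis by blast
qed

lemma subspace_kernel: "subspace {v. X *v v = (0::real^'m)}"
  by (auto simp: subspace_def matrix_vector_right_distrib matrix_vector_mult_scaleR)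

text \<open>
  The minimum of the form over the compact unit sphere of \<open>S\<close> is positive and serves as \<open>d\<close>.
\<close>

lemma quad_coercive:
  fixes M :: "real^'n^'n"
  assumes S: "subspace S" and pos: "\<And>v. v \<in> S \<Longrightarrow> v \<noteq> 0 \<Longrightarrow> 0 < quad M v"
  obtains d where "d > 0" "\<And>v. v \<in> S \<Longrightarrow> d * (norm v)\<^sup>2 \<le> quad M v"
proof (cases "S \<inter> sphere 0 1 = {}")
  case True
  have "v = 0" if "v \<in> S" for v
  proof (rule ccontr)
    assume "v \<noteq> 0"
    then have "(1 / norm v) *\<^sub>R v \<in> S \<inter> sphere 0 1"
      using S that by (simp add: subspace_scale)
    with True show False by blast
  qed
  then have "1 * (norm v)\<^sup>2 \<le> quad M v" if "v \<in> S" for v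
    using that by (force simp: quad_def)
  with that[of 1] show thesis by simp
next
  case False
  have "compact (S \<inter> sphere 0 1)"
    using S by (intro closed_Int_compact closed_subspace) auto
  moreover have "continuous_on (S \<inter> sphere 0 1) (quad M)"
    unfolding quad_def
    by (intro continuous_intros linear_continuous_on matrix_vector_mul_bounded_linear)
  ultimately obtain w where w: "w \<in> S" "norm w = 1"
    and min: "\<And>v. v \<in> S \<Longrightarrow> norm v = 1 \<Longrightarrow> quad M w \<le> quad M v"
    using continuous_attains_inf[of "S \<inter> sphere 0 1" "quad M"] False
    by (metis IntE IntI mem_sphere_0)
  have "quad M w * (norm v)\<^sup>2 \<le> quad M v" if "v \<in> S" for v
  proof (cases "v = 0")
    case False
    define u where "u = (1 / norm v) *\<^sub>R v"
    have "u \<in> S" "norm u = 1" "v = norm v *\<^sub>R u"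
      using False S that by (auto simp: u_def subspace_scale)
    then show ?thesis
      using min[of u] quad_scaleR_arg[of M "norm v" u]
      by (simp add: mult.commute mult_right_mono)
  qed (simp add: quad_def)
  moreover have "quad M w > 0"
    using pos[OF w(1)] w(2) by force
  ultimately show thesis using that by blast
qed

text \<open>
  Near \<open>0\<close> a nonzero linear term dominates the quadratic one, so a short step against \<open>z\<close> makes
  the sum negative. The same fact gives the kernel of a semidefinite form and the decrease along a
  degenerate direction in \<open>residual_lower_bound\<close>.
\<close>

lemma quad_affine_negative:
  assumes nn: "\<And>y. 0 \<le> quad A y" and "z \<noteq> 0"
  obtains y where "quad A y + 2 * (z \<bullet> y) < 0"
proof
  define s where "s = (norm z)\<^sup>2 / (1 + quad A z)"
  have pos: "0 < 1 + quad A z" and s: "s > 0"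
    using nn[of z] assms(2) by (auto simp: s_def)
  have "s * (1 + quad A z) = (norm z)\<^sup>2"
    using pos by (simp add: s_def)
  then have eq: "s * (s * (1 + quad A z)) = s * (norm z)\<^sup>2" by simp
  have "s * (norm z)\<^sup>2 > 0" "s * s > 0" using s assms(2) by auto
  then show "quad A ((- s) *\<^sub>R z) + 2 * (z \<bullet> ((- s) *\<^sub>R z)) < 0"
    using eq unfolding quad_scaleR_arg power2_norm_eq_inner
    by (simp add: power2_eq_square algebra_simps)
qed

text \<open>
  A zero of a nonnegative form is a minimum, and \<open>X *v v\<close> is half the gradient there.
\<close>

lemma psd_quad_zero_imp_kernel:
  assumes "X \<in> psd_cone" "quad X v = 0"
  shows "X *v v = 0"
proof (rule ccontr)
  assume "X *v v \<noteq> 0"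
  then obtain y where "quad X y + 2 * ((X *v v) \<bullet> y) < 0"
    using quad_affine_negative[of X "X *v v"] assms(1) by (auto simp: psd_cone_iff)
  then have "quad X (y + v) < 0"
    using assms by (simp add: psd_cone_iff quad_add_arg inner_commute)
  then show False
    using assms(1) by (auto simp: psd_cone_iff not_less[symmetric])
qed

lemma psd_coercive_off_kernel:
  assumes A: "A \<in> psd_cone"
  obtains d where "d > 0"
    "\<And>u. (\<And>w. A *v w = 0 \<Longrightarrow> orthogonal u w) \<Longrightarrow> d * (norm u)\<^sup>2 \<le> quad A u"
proof -
  (* S is the orthogonal complement of the kernel, on which the form has no zero but 0. *)
  define S where "S = {u. \<forall>w. A *v w = 0 \<longrightarrow> orthogonal u w}"
  have "subspace S"
    by (auto simp: S_def subspace_def orthogonal_def inner_add_left)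
  moreover have "0 < quad A u" if "u \<in> S" "u \<noteq> 0" for u
  proof -
    have "A *v u \<noteq> 0"
      using that by (auto simp: S_def orthogonal_def)
    then show ?thesis
      using A psd_quad_zero_imp_kernel[OF A, of u] by (auto simp: psd_cone_iff less_le)
  qed
  ultimately obtain d where "d > 0" "\<And>u. u \<in> S \<Longrightarrow> d * (norm u)\<^sup>2 \<le> quad A u"
    using quad_coercive by blast
  with that show thesis by (auto simp: S_def)
qed

lemma kernel_decomp:
  fixes A :: "real^'n^'n"
  obtains u w where "v = u + w" "A *v w = 0" "\<And>w'. A *v w' = 0 \<Longrightarrow> orthogonal u w'"
proof -
  have sp: "span {w. A *v w = 0} = {w. A *v w = 0}"
    using subspace_kernel by (rule span_eq_iff[THEN iffD2])
  obtain w u where "w \<in> span {w. A *v w = 0}"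
      "\<And>w'. w' \<in> span {w. A *v w = 0} \<Longrightarrow> orthogonal u w'" "v = w + u"
    using orthogonal_subspace_decomp_exists[of "{w. A *v w = 0}" v] by blast
  then show thesis
    using that[of u w] unfolding sp by (auto simp: add.commute)
qed

section \<open>Rank-one matrices\<close>

definition outer :: "real^'n \<Rightarrow> real^'n^'n" where
  "outer u = (\<chi> i j. u $ i * u $ j)"

lemma inner_outer: "outer u \<bullet> X = quad X u"
  by (simp add: outer_def quad_def inner_vec_def matrix_vector_mult_def sum_distrib_left mult_ac)

lemma outer_mult: "outer u *v v = (u \<bullet> v) *\<^sub>R u"
  by (simp add: outer_def vec_eq_iff matrix_vector_mult_def inner_vec_def
      sum_distrib_left sum_distrib_right mult_ac)

lemma quad_outer: "quad (outer u) v = (u \<bullet> v)\<^sup>2"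
  by (simp add: quad_def outer_mult power2_eq_square inner_commute)

lemma norm_outer: "norm (outer u) = (norm u)\<^sup>2"
  by (simp add: norm_eq_sqrt_inner[of "outer u"] inner_outer quad_outer power2_norm_eq_inner)

lemma outer_psd: "outer u \<in> psd_cone"
  by (simp add: psd_cone_iff quad_outer sym_matrices_def)
     (simp add: outer_def transpose_def vec_eq_iff mult.commute)

section \<open>The cone of positive semidefinite matrices and projections onto it\<close>

lemma psd_add: "X \<in> psd_cone \<Longrightarrow> Y \<in> psd_cone \<Longrightarrow> X + Y \<in> psd_cone"
  by (simp add: psd_cone_iff quad_add subspace_add[OF subspace_sym_matrices])

lemma psd_scaleR: "X \<in> psd_cone \<Longrightarrow> 0 \<le> c \<Longrightarrow> c *\<^sub>R X \<in> psd_cone"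
  by (simp add: psd_cone_iff quad_scaleR subspace_scale[OF subspace_sym_matrices])

lemma psd_sum: "(\<And>i. i \<in> I \<Longrightarrow> f i \<in> psd_cone) \<Longrightarrow> sum f I \<in> psd_cone"
  by (induction I rule: infinite_finite_induct)
     (auto simp: psd_add psd_cone_iff[of 0] quad_def subspace_0[OF subspace_sym_matrices])

lemma convex_psd_cone: "convex psd_cone"
  by (auto simp: convex_def psd_add psd_scaleR)

lemma closed_psd_cone: "closed (psd_cone :: (real^'n^'n) set)"
proof -
  have "closed {X :: real^'n^'n. \<forall>v. 0 \<le> outer v \<bullet> X}"
    by (intro closed_Collect_all closed_Collect_le continuous_intros)
  moreover have "psd_cone = sym_matrices \<inter> {X :: real^'n^'n. \<forall>v. 0 \<le> outer v \<bullet> X}"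
    by (auto simp: psd_cone_iff inner_outer)
  moreover have "closed (sym_matrices :: (real^'n^'n) set)"
    by (rule closed_subspace[OF subspace_sym_matrices])
  ultimately show ?thesis by (metis closed_Int)
qed

text \<open>
  The Moreau decomposition of \<open>U\<close> with respect to the cone. The orthogonality of \<open>P\<close> and the
  residual \<open>P - U\<close> is stated as a formula for the inner product of the residual with \<open>U\<close>, which
  is the form in which the line through \<open>A\<close> enters.
\<close>

lemma psd_projection:
  fixes U :: "real^'n^'n"
  defines "P \<equiv> closest_point psd_cone U"
  shows psd_projection_mem: "P \<in> psd_cone"
    and psd_projection_residual_dual: "\<And>X. X \<in> psd_cone \<Longrightarrow> 0 \<le> (P - U) \<bullet> X"
    and psd_projection_residual_inner: "(P - U) \<bullet> U = - (norm (P - U))\<^sup>2"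
proof -
  have ne: "psd_cone \<noteq> ({} :: (real^'n^'n) set)" using outer_psd by blast
  show P: "P \<in> psd_cone"
    unfolding P_def by (rule closest_point_in_set[OF closed_psd_cone ne])
  have dot: "(U - P) \<bullet> (X - P) \<le> 0" if "X \<in> psd_cone" for X
    unfolding P_def by (rule closest_point_dot[OF convex_psd_cone closed_psd_cone that])
  show "0 \<le> (P - U) \<bullet> X" if "X \<in> psd_cone" for X
    using dot[OF psd_add[OF P that]] by (simp add: inner_diff_left)
  (* The multiples 0 and 2P of P both lie in the cone, so the residual is orthogonal to P. *)
  have "(P - U) \<bullet> P = 0"
    using dot[OF psd_scaleR[OF P, of 0]] dot[OF psd_scaleR[OF P, of 2]]
    by (simp add: inner_diff_left scaleR_2)
  then show "(P - U) \<bullet> U = - (norm (P - U))\<^sup>2"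
    by (simp add: power2_norm_eq_inner inner_diff_right)
qed

lemma closest_point_line:
  fixes A B X :: "'a :: euclidean_space"
  assumes "B \<noteq> 0"
  shows "closest_point (range (\<lambda>t. A + t *\<^sub>R B)) X
    = A + (((X - A) \<bullet> B) / (norm B)\<^sup>2) *\<^sub>R B"
proof -
  define E where "E = range (\<lambda>t. A + t *\<^sub>R B)"
  define s where "s = ((X - A) \<bullet> B) / (norm B)\<^sup>2"
  have E: "E = (\<lambda>x. A + x) ` span {B}"
    by (auto simp: E_def span_singleton)
  have cE: "closed E" "convex E"
    unfolding E by (auto intro: closed_translation convex_translation subspace_imp_convex)
  have orth: "(X - (A + s *\<^sub>R B)) \<bullet> B = 0"
    using assms by (simp add: s_def inner_diff_left inner_add_left power2_norm_eq_inner)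
  have "dist X (A + s *\<^sub>R B) \<le> dist X Z" if "Z \<in> E" for Z
  proof -
    from that obtain t where t: "Z = A + t *\<^sub>R B" by (auto simp: E_def)
    have "X - Z = (X - (A + s *\<^sub>R B)) + (s - t) *\<^sub>R B"
      by (simp add: t algebra_simps)
    then have "(norm (X - Z))\<^sup>2 = (norm (X - (A + s *\<^sub>R B)))\<^sup>2 + (norm ((s - t) *\<^sub>R B))\<^sup>2"
      using orth by (simp only: norm_add_Pythagorean orthogonal_def inner_scaleR_right mult_zero_right)
    then have "(norm (X - (A + s *\<^sub>R B)))\<^sup>2 \<le> (norm (X - Z))\<^sup>2" by simp
    then show ?thesis unfolding dist_norm by (rule power2_le_imp_le) simp
  qed
  moreover have "A + s *\<^sub>R B \<in> E" by (auto simp: E_def)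
  ultimately have "A + s *\<^sub>R B = closest_point E X"
    using closest_point_unique[OF cE(2,1)] by blast
  then show ?thesis by (simp add: E_def s_def)
qed

section \<open>Singularity degree greater than one forces semidefiniteness on the kernel\<close>

text \<open>
  The kernel condition lets both forms be evaluated on the orthogonal complement of the kernel of
  \<open>A\<close>, where \<open>A\<close> is coercive and hence dominates a small multiple of \<open>X\<close>.
\<close>

lemma psd_subtract_multiple:
  assumes A: "A \<in> psd_cone" and X: "X \<in> sym_matrices"
    and ker: "\<And>v. A *v v = 0 \<Longrightarrow> X *v v = 0"
  obtains \<epsilon> where "\<epsilon> > 0" "A - \<epsilon> *\<^sub>R X \<in> psd_cone"
proof -
  obtain d where d: "d > 0"
    "\<And>u. (\<And>w. A *v w = 0 \<Longrightarrow> orthogonal u w) \<Longrightarrow> d * (norm u)\<^sup>2 \<le> quad A u"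
    using psd_coercive_off_kernel[OF A] by blast
  obtain \<beta> where \<beta>: "\<beta> > 0" "\<And>u v. \<bar>u \<bullet> (X *v v)\<bar> \<le> \<beta> * norm u * norm v"
    using bilinear_bound by blast
  have As: "A \<in> sym_matrices" using A by (simp add: psd_cone_iff)
  define Y where "Y = A - (d / \<beta>) *\<^sub>R X"
  have Y: "Y \<in> sym_matrices"
    unfolding Y_def using As X subspace_sym_matrices by (intro subspace_diff subspace_scale)
  have quadY: "quad Y v = quad A v - (d / \<beta>) * quad X v" for v
    using quad_add[of Y "(d / \<beta>) *\<^sub>R X" v] by (simp add: Y_def quad_scaleR)
  have "0 \<le> quad Y v" for v
  proof -
    obtain u w where v: "v = u + w" and w: "A *v w = 0"
      and u: "\<And>w'. A *v w' = 0 \<Longrightarrow> orthogonal u w'"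
      using kernel_decomp by blast
    have "(d / \<beta>) * quad X u \<le> (d / \<beta>) * (\<beta> * norm u * norm u)"
      using \<beta>(2)[of u u] d(1) \<beta>(1) by (intro mult_left_mono) (auto simp: quad_def)
    also have "\<dots> = d * (norm u)\<^sup>2"
      using \<beta>(1) by (simp add: power2_eq_square)
    also have "\<dots> \<le> quad A u" using d(2) u by blast
    finally show ?thesis
      using quad_add_kernel[OF As w] quad_add_kernel[OF X ker[OF w]] by (simp add: quadY v)
  qed
  then have "Y \<in> psd_cone" using Y by (simp add: psd_cone_iff)
  then show thesis using that[of "d / \<beta>"] d(1) \<beta>(1) by (simp add: Y_def)
qed

text \<open>
  By \<open>ker\<close>, every \<open>X\<close> in the exposed face can be subtracted from \<open>A\<close> in a small multiple without
  leaving the cone. Then \<open>A\<close> lies strictly between \<open>X\<close> and another point of the cone, and any face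
  that contains \<open>A\<close> contains \<open>X\<close>.
\<close>

lemma exposed_face_eq_minimal_face:
  assumes A: "A \<in> psd_cone" and E: "psd_cone \<inter> E = {A}"
    and U: "U \<in> psd_cone" "U \<bullet> A = 0"
    and dual: "\<forall>X\<in>psd_cone. 0 \<le> U \<bullet> X"
    and ker: "\<forall>X\<in>psd_cone. U \<bullet> X = 0 \<longrightarrow> (\<forall>v. A *v v = 0 \<longrightarrow> X *v v = 0)"
  shows "psd_cone \<inter> sym_perp {U} face_of psd_cone"
    and "psd_cone \<inter> sym_perp {U} = minimal_face E"
proof -
  have eq: "psd_cone \<inter> sym_perp {U} = psd_cone \<inter> {X. U \<bullet> X = 0}"
    by (auto simp: sym_perp_def psd_cone_iff inner_commute)
  show face: "psd_cone \<inter> sym_perp {U} face_of psd_cone"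
    unfolding eq using convex_psd_cone dual by (blast intro: face_of_Int_supporting_hyperplane_ge)
  have "X \<in> F" if X: "X \<in> psd_cone" "U \<bullet> X = 0" and F: "F face_of psd_cone" "A \<in> F" for X F
  proof (cases "X = A")
    case False
    obtain \<epsilon> where \<epsilon>: "\<epsilon> > 0" "A - \<epsilon> *\<^sub>R X \<in> psd_cone"
      using psd_subtract_multiple[OF A, of X] ker X by (auto simp: psd_cone_iff)
    (* The segment from X to A, prolonged a little beyond A. *)
    define Y where "Y = A + \<epsilon> *\<^sub>R (A - X)"
    have "Y = (A - \<epsilon> *\<^sub>R X) + \<epsilon> *\<^sub>R A" by (simp add: Y_def algebra_simps)
    then have Y: "Y \<in> psd_cone" using \<epsilon> A by (simp add: psd_add psd_scaleR)
    have "X \<noteq> Y"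
    proof
      assume "X = Y"
      then have "(1 + \<epsilon>) *\<^sub>R (X - A) = 0" by (simp add: Y_def algebra_simps)
      then show False using \<epsilon>(1) False by simp
    qed
    moreover have "(1 + \<epsilon>) *\<^sub>R A = (1 + \<epsilon>) *\<^sub>R ((1 - 1 / (1 + \<epsilon>)) *\<^sub>R X + (1 / (1 + \<epsilon>)) *\<^sub>R Y)"
    proof -
      have "(1 + \<epsilon>) * (1 - 1 / (1 + \<epsilon>)) = \<epsilon>" "(1 + \<epsilon>) * (1 / (1 + \<epsilon>)) = 1"
        using \<epsilon>(1) by (auto simp: field_simps)
      then have "(1 + \<epsilon>) *\<^sub>R ((1 - 1 / (1 + \<epsilon>)) *\<^sub>R X + (1 / (1 + \<epsilon>)) *\<^sub>R Y) = \<epsilon> *\<^sub>R X + 1 *\<^sub>R Y"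
        by (simp only: scaleR_add_right scaleR_scaleR)
      then show ?thesis by (simp add: Y_def algebra_simps)
    qed
    then have "A = (1 - 1 / (1 + \<epsilon>)) *\<^sub>R X + (1 / (1 + \<epsilon>)) *\<^sub>R Y"
      using \<epsilon>(1) by (simp only: scaleR_cancel_left) simp
    ultimately have "A \<in> open_segment X Y"
      unfolding in_segment using \<epsilon>(1)
      by (intro conjI exI[of _ "1 / (1 + \<epsilon>)"]) simp_all
    then show ?thesis using face_ofD[OF F(1) _ X(1) Y F(2)] by simp
  qed (use F in simp)
  then have "psd_cone \<inter> sym_perp {U} \<subseteq> minimal_face E"
    using E by (auto simp: eq minimal_face_def Int_commute)
  moreover have "minimal_face E \<subseteq> psd_cone \<inter> sym_perp {U}"
  proof -
    have "A \<in> psd_cone \<inter> sym_perp {U}" unfolding eq using A U(2) by simp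
    then show ?thesis using face E unfolding minimal_face_def
      by (intro Inter_lower) (simp add: Int_commute)
  qed
  ultimately show "psd_cone \<inter> sym_perp {U} = minimal_face E" by blast
qed

text \<open>
  The orthogonal complement of the \<open>C k\<close> in the symmetric matrices is the direction space of the
  affine space, that is, the line through \<open>B\<close>. The component of \<open>U\<close> orthogonal to the \<open>C k\<close> is
  thus a multiple of \<open>B\<close>, while \<open>U\<close> is orthogonal to \<open>B\<close>; so the component vanishes. The second
  equation is \<open>U \<bullet> A = 0\<close> read off at the point \<open>A\<close> of the affine space.
\<close>

lemma affine_space_line_normal:
  assumes B: "B \<in> sym_matrices" and C: "\<And>k. k \<in> {1..p} \<Longrightarrow> C k \<in> sym_matrices"
    and E: "affine_space p C b = range (\<lambda>t. A + t *\<^sub>R B)"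
    and U: "U \<in> sym_matrices" "U \<bullet> A = 0" "U \<bullet> B = 0"
  obtains y where "(\<Sum>k=1..p. y k *\<^sub>R C k) = U" "(\<Sum>k=1..p. b k * y k) = 0"
proof -
  define S where "S = {\<Sum>k=1..p. y k *\<^sub>R C k | y :: nat \<Rightarrow> real. True}"
  have CS: "C k \<in> S" if "k \<in> {1..p}" for k
  proof -
    have "C k = (\<Sum>j=1..p. (if j = k then 1 else 0) *\<^sub>R C j)"
      using that by (simp add: if_distrib[of "\<lambda>c. c *\<^sub>R _"] cong: if_cong)
    then show ?thesis
      unfolding S_def mem_Collect_eq
      by (rule exI[of _ "\<lambda>j. if j = k then 1 else 0", OF conjI[OF _ TrueI]])
  qed
  have "subspace S"
  proof (rule subspaceI)
    show "0 \<in> S" by (auto simp: S_def intro!: exI[of _ "\<lambda>_. 0"])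
  next
    fix X Y assume "X \<in> S" "Y \<in> S"
    then obtain y z where "X = (\<Sum>k=1..p. y k *\<^sub>R C k)" "Y = (\<Sum>k=1..p. z k *\<^sub>R C k)"
      by (auto simp: S_def)
    then have "X + Y = (\<Sum>k=1..p. (y k + z k) *\<^sub>R C k)"
      by (simp add: scaleR_add_left sum.distrib)
    then show "X + Y \<in> S" unfolding S_def by (auto intro!: exI[of _ "\<lambda>k. y k + z k"])
  next
    fix c X assume "X \<in> S"
    then obtain y where "X = (\<Sum>k=1..p. y k *\<^sub>R C k)" by (auto simp: S_def)
    then have "c *\<^sub>R X = (\<Sum>k=1..p. (c * y k) *\<^sub>R C k)" by (simp add: scaleR_sum_right)
    then show "c *\<^sub>R X \<in> S" unfolding S_def by (auto intro!: exI[of _ "\<lambda>k. c * y k"])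
  qed
  then have span: "span S = S" by simp
  have "A \<in> affine_space p C b" unfolding E by (auto intro!: exI[of _ 0])
  then have As: "A \<in> sym_matrices" and bA: "\<And>k. k \<in> {1..p} \<Longrightarrow> C k \<bullet> A = b k"
    by (auto simp: affine_space_def)
  obtain X Z where X: "X \<in> S" and Z: "\<And>Y. Y \<in> S \<Longrightarrow> orthogonal Z Y" and XZ: "U = X + Z"
    using orthogonal_subspace_decomp_exists[of S U] span by metis
  obtain y where y: "X = (\<Sum>k=1..p. y k *\<^sub>R C k)" using X by (auto simp: S_def)
  have "X \<in> sym_matrices"
    unfolding y using C by (intro subspace_sum subspace_scale subspace_sym_matrices) auto
  then have "Z \<in> sym_matrices"
    using U(1) XZ subspace_diff[OF subspace_sym_matrices, of U X] by simp
  moreover have "C k \<bullet> Z = 0" if "k \<in> {1..p}" for k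
    using Z[OF CS[OF that]] by (simp add: orthogonal_def inner_commute)
  ultimately have "A + Z \<in> affine_space p C b"
    using As bA subspace_add[OF subspace_sym_matrices]
    by (simp add: affine_space_def inner_add_right)
  then obtain t where "A + Z = A + t *\<^sub>R B" unfolding E by blast
  then have "Z = t *\<^sub>R B" by simp
  then have "Z \<bullet> U = 0" using U(3) by (simp add: inner_commute)
  moreover have "Z \<bullet> X = 0" using Z[OF X] by (simp add: orthogonal_def)
  ultimately have "Z = 0" using XZ by (simp add: inner_add_right)
  then have yU: "(\<Sum>k=1..p. y k *\<^sub>R C k) = U" using XZ y by simp
  have "(\<Sum>k=1..p. b k * y k) = (\<Sum>k=1..p. y k *\<^sub>R C k) \<bullet> A"
    by (simp add: inner_sum_left bA mult.commute)
  then show thesis using that yU U(2) by simp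
qed

text \<open>
  The sum \<open>T\<close> of the matrices \<open>outer e\<close> over a basis of the kernel is positive definite on the
  kernel. Its inner product with \<open>B\<close> is cancelled by adding a nonnegative multiple of \<open>outer z\<close>,
  where \<open>z\<close> is \<open>u\<close> or \<open>w\<close> according to the sign of \<open>T \<bullet> B\<close>. Orthogonality to such
  a \<open>U\<close> forces a positive semidefinite matrix to vanish on the basis, hence on the kernel.
\<close>

lemma indefinite_on_kernel_imp_certificate:
  fixes A B :: "real^'n^'n"
  assumes pos: "A *v u = 0" "0 < quad B u" and neg: "A *v w = 0" "quad B w < 0"
  obtains U where "U \<in> psd_cone" "U \<noteq> 0" "U \<bullet> A = 0" "U \<bullet> B = 0"
    "\<forall>X\<in>psd_cone. 0 \<le> U \<bullet> X"
    "\<forall>X\<in>psd_cone. U \<bullet> X = 0 \<longrightarrow> (\<forall>v. A *v v = 0 \<longrightarrow> X *v v = 0)"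
proof -
  define K where "K = {v. A *v v = 0}"
  have K: "subspace K" unfolding K_def by (rule subspace_kernel)
  obtain S where S: "S \<subseteq> K" "independent S" "K \<subseteq> span S"
    using maximal_independent_subset[of K] by blast
  have fin: "finite S" using S(2) by (rule independent_imp_finite)
  define T where "T = (\<Sum>e\<in>S. outer e)"
  have TX: "T \<bullet> X = (\<Sum>e\<in>S. quad X e)" for X
    by (simp add: T_def inner_sum_left inner_outer)
  obtain z \<alpha> where z: "z \<in> K" and \<alpha>: "0 \<le> \<alpha>" "T \<bullet> B + \<alpha> * quad B z = 0"
  proof (cases "T \<bullet> B \<ge> 0")
    case True
    then show thesis
      using that[of w "- (T \<bullet> B) / quad B w"] neg by (simp add: K_def divide_nonneg_neg)
  next
    case False
    then show thesis
      using that[of u "- (T \<bullet> B) / quad B u"] pos by (simp add: K_def divide_nonpos_pos)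
  qed
  define U where "U = T + \<alpha> *\<^sub>R outer z"
  have UX: "U \<bullet> X = (\<Sum>e\<in>S. quad X e) + \<alpha> * quad X z" for X
    by (simp add: U_def inner_add_left TX inner_outer)
  have Upsd: "U \<in> psd_cone"
    unfolding U_def T_def using \<alpha>(1) by (intro psd_add psd_sum psd_scaleR outer_psd) auto
  have UA: "U \<bullet> A = 0"
    using S(1) z by (auto simp: UX quad_def K_def intro!: sum.neutral)
  have UB: "U \<bullet> B = 0" using \<alpha>(2) by (simp add: UX TX)
  have dual: "0 \<le> U \<bullet> X" if "X \<in> psd_cone" for X
    using that \<alpha>(1) unfolding UX psd_cone_iff by (intro add_nonneg_nonneg sum_nonneg) auto
  have ker: "X *v v = 0" if X: "X \<in> psd_cone" and "U \<bullet> X = 0" and v: "A *v v = 0" for X v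
  proof -
    have nn: "\<And>e. 0 \<le> quad X e" using X by (simp add: psd_cone_iff)
    have "(\<Sum>e\<in>S. quad X e) = 0"
      using that(2) sum_nonneg[of S "quad X"] nn mult_nonneg_nonneg[OF \<alpha>(1) nn[of z]]
      by (simp add: UX add_nonneg_eq_0_iff)
    then have "\<And>e. e \<in> S \<Longrightarrow> X *v e = 0"
      using fin nn by (simp add: sum_nonneg_eq_0_iff psd_quad_zero_imp_kernel[OF X])
    then have "span S \<subseteq> {x. X *v x = 0}"
      using subspace_kernel by (intro span_minimal) auto
    then show ?thesis using S(3) v by (auto simp: K_def)
  qed
  (* A zero certificate would force every positive semidefinite matrix to vanish at u. *)
  have "U \<noteq> 0"
  proof
    assume "U = 0"
    then have "outer u *v u = 0" using ker[OF outer_psd _ pos(1)] by simp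
    then show False using pos(2) by (auto simp: outer_mult quad_def)
  qed
  with that Upsd UA UB dual ker show thesis by simp
qed

text \<open>
  Otherwise the matrix of \<open>indefinite_on_kernel_imp_certificate\<close>, together with \<open>V = 0\<close>, yields a
  facial reduction sequence of length one.
\<close>

lemma singularity_degree_gt_1_imp_semidefinite_on_kernel:
  assumes A: "A \<in> psd_cone" and B: "B \<in> sym_matrices"
    and C: "\<And>k. k \<in> {1..p} \<Longrightarrow> C k \<in> sym_matrices"
    and E: "affine_space p C b = range (\<lambda>t. A + t *\<^sub>R B)"
    and single: "psd_cone \<inter> affine_space p C b = {A}"
    and deg: "singularity_degree p C b > 1"
  shows "(\<forall>v. A *v v = 0 \<longrightarrow> 0 \<le> quad B v) \<or> (\<forall>v. A *v v = 0 \<longrightarrow> quad B v \<le> 0)"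
proof (rule ccontr)
  assume "\<not> ?thesis"
  then obtain u w where "A *v u = 0" "0 < quad B u" "A *v w = 0" "quad B w < 0"
    unfolding de_Morgan_disj not_all not_imp not_le by (elim conjE exE)
  then obtain U where U: "U \<in> psd_cone" "U \<noteq> 0" "U \<bullet> A = 0" "U \<bullet> B = 0"
    and dual: "\<forall>X\<in>psd_cone. 0 \<le> U \<bullet> X"
    and ker: "\<forall>X\<in>psd_cone. U \<bullet> X = 0 \<longrightarrow> (\<forall>v. A *v v = 0 \<longrightarrow> X *v v = 0)"
    by (rule indefinite_on_kernel_imp_certificate)
  have Us: "U \<in> sym_matrices" using U(1) by (simp add: psd_cone_iff)
  obtain y where y: "(\<Sum>k=1..p. y k *\<^sub>R C k) = U" "(\<Sum>k=1..p. b k * y k) = 0"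
    using affine_space_line_normal[OF B C E Us U(3,4)] by blast
  note face = exposed_face_eq_minimal_face[OF A single U(1,3) dual ker]
  have nperp: "U \<notin> sym_perp psd_cone"
    using U(2) inner_eq_zero_iff[of U] bspec[OF _ U(1), of "\<lambda>X. U \<bullet> X = 0"]
    by (auto simp: sym_perp_def)
  have zperp: "0 \<in> sym_perp psd_cone"
    using subspace_0[OF subspace_sym_matrices] by (simp add: sym_perp_def)
  define F where "F i = (if i = 0 then psd_cone else psd_cone \<inter> sym_perp {U})" for i :: nat
  have faces: "F i face_of psd_cone" for i
    using face(1) by (simp add: F_def face_of_refl convex_psd_cone)
  have F01: "F 0 = psd_cone" "F 1 = psd_cone \<inter> sym_perp {U}" by (simp_all add: F_def)
  have "\<exists>y U V. U \<in> psd_cone \<and> V \<in> sym_perp (F (i - 1)) \<and> (\<Sum>k=1..p. b k * y k) = 0 \<and>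
        (\<Sum>k=1..p. y k *\<^sub>R C k) = U + V \<and> U + V \<notin> sym_perp (F (i - 1)) \<and>
        F i = F (i - 1) \<inter> sym_perp {U}" if "i \<in> {1..1}" for i
  proof -
    have i: "i = 1" using that by simp
    show ?thesis
      unfolding i diff_self_eq_0 F01
      by (rule exI[of _ y], rule exI[of _ U], rule exI[of _ 0]) (use y U(1) nperp zperp in simp)
  qed
  then have "facial_reduction_sequence p C b 1 F"
    unfolding facial_reduction_sequence_def using faces F01 face(2) by simp
  then have "singularity_degree p C b \<le> 1"
    unfolding singularity_degree_def by (intro Least_le exI)
  then show False using deg by simp
qed

section \<open>The size of the projection residual along the line\<close>

text \<open>
  Suppose that \<open>B\<close> annihilates every zero of its form on the kernel of \<open>A\<close>. Then \<open>A + t B\<close>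
  vanishes on the space \<open>L\<close> of these zeros, while \<open>B\<close> is coercive on the orthogonal complement \<open>M\<close>
  of \<open>L\<close> in the kernel and \<open>A\<close> is coercive on the orthogonal complement of the kernel. Completing
  the square absorbs the mixed term, which carries the factor \<open>t\<close> as well, so \<open>A + t B\<close> is
  positive semidefinite for small \<open>t\<close>.
\<close>

lemma degenerate_kernel_direction:
  assumes A: "A \<in> psd_cone" and B: "B \<in> sym_matrices"
    and nn: "\<And>v. A *v v = 0 \<Longrightarrow> 0 \<le> quad B v"
    and out: "\<And>t. t > 0 \<Longrightarrow> A + t *\<^sub>R B \<notin> psd_cone"
  obtains v where "A *v v = 0" "quad B v = 0" "B *v v \<noteq> 0"
proof (rule ccontr)
  assume "\<not> thesis"
  then have deg: "\<And>v. A *v v = 0 \<Longrightarrow> quad B v = 0 \<Longrightarrow> B *v v = 0" using that by blast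
  have As: "A \<in> sym_matrices" using A by (simp add: psd_cone_iff)
  obtain d where d: "d > 0"
    "\<And>u. (\<And>w. A *v w = 0 \<Longrightarrow> orthogonal u w) \<Longrightarrow> d * (norm u)\<^sup>2 \<le> quad A u"
    using psd_coercive_off_kernel[OF A] by blast
  define L where "L = {v. A *v v = 0} \<inter> {v. B *v v = 0}"
  have L: "subspace L" unfolding L_def by (intro subspace_inter subspace_kernel)
  define M where "M = {v. A *v v = 0} \<inter> {v. \<forall>w\<in>L. orthogonal v w}"
  have M: "subspace M"
    unfolding M_def
    by (intro subspace_inter subspace_kernel)
       (auto simp: subspace_def orthogonal_def inner_add_left)
  have "0 < quad B v" if "v \<in> M" "v \<noteq> 0" for v
  proof -
    have "v \<notin> L" using that by (auto simp: M_def orthogonal_def)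
    then have "quad B v \<noteq> 0" using deg that by (auto simp: L_def M_def)
    then show ?thesis using nn that by (auto simp: M_def less_le)
  qed
  with M obtain \<gamma> where \<gamma>: "\<gamma> > 0" "\<And>v. v \<in> M \<Longrightarrow> \<gamma> * (norm v)\<^sup>2 \<le> quad B v"
    using quad_coercive by blast
  obtain \<beta> where \<beta>: "\<beta> > 0" "\<And>u v. \<bar>u \<bullet> (B *v v)\<bar> \<le> \<beta> * norm u * norm v"
    using bilinear_bound by blast
  (* The loss beta + beta^2 / gamma is what remains after completing the square in norm m. *)
  define t where "t = d / (\<beta> + \<beta>\<^sup>2 / \<gamma>)"
  have den: "\<beta> + \<beta>\<^sup>2 / \<gamma> > 0" using \<beta>(1) \<gamma>(1) by (simp add: add_pos_pos)
  have t: "t > 0" "t * (\<beta> + \<beta>\<^sup>2 / \<gamma>) = d" using d(1) den by (auto simp: t_def)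
  have "0 \<le> quad (A + t *\<^sub>R B) v" for v
  proof -
    obtain u w where v: "v = u + w" and w: "A *v w = 0"
      and u: "\<And>w'. A *v w' = 0 \<Longrightarrow> orthogonal u w'"
      using kernel_decomp by blast
    obtain l m where l: "l \<in> span L" and m: "\<And>x. x \<in> span L \<Longrightarrow> orthogonal m x"
      and wlm: "w = l + m"
      using orthogonal_subspace_decomp_exists[of L w] by blast
    have lL: "l \<in> L" using l L by (simp add: span_eq_iff[THEN iffD2])
    have "A *v m = 0"
      using w lL by (simp add: wlm L_def matrix_vector_right_distrib)
    then have mM: "m \<in> M" using m by (auto simp: M_def span_base)
    have "quad A v = quad A u"
      unfolding v by (rule quad_add_kernel[OF As w])
    then have qA: "quad A v \<ge> d * (norm u)\<^sup>2" using d(2) u by simp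
    have "quad B v = quad B (u + m)"
      using lL quad_add_kernel[OF B, of l "u + m"] by (simp add: v wlm L_def add_ac)
    also have "\<dots> \<ge> - \<beta> * (norm u)\<^sup>2 - 2 * (\<beta> * norm u * norm m) + \<gamma> * (norm m)\<^sup>2"
      unfolding quad_add_arg[OF B] using \<beta>(2)[of u u] \<beta>(2)[of u m] \<gamma>(2)[OF mM]
      by (simp add: quad_def power2_eq_square abs_le_iff)
    finally have "quad B v \<ge> - \<beta> * (norm u)\<^sup>2 - 2 * (\<beta> * norm u * norm m) + \<gamma> * (norm m)\<^sup>2" .
    moreover have "- \<beta> * (norm u)\<^sup>2 - 2 * (\<beta> * norm u * norm m) + \<gamma> * (norm m)\<^sup>2
      = \<gamma> * (norm m - \<beta> * norm u / \<gamma>)\<^sup>2 - (\<beta> + \<beta>\<^sup>2 / \<gamma>) * (norm u)\<^sup>2"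
      using \<gamma>(1) by (simp add: power2_eq_square field_simps)
    moreover have "0 \<le> \<gamma> * (norm m - \<beta> * norm u / \<gamma>)\<^sup>2" using \<gamma>(1) by simp
    ultimately have "quad B v \<ge> - (\<beta> + \<beta>\<^sup>2 / \<gamma>) * (norm u)\<^sup>2"
      unfolding mult_minus_left by linarith
    then have "t * quad B v \<ge> t * (- (\<beta> + \<beta>\<^sup>2 / \<gamma>) * (norm u)\<^sup>2)"
      using t(1) by (intro mult_left_mono) auto
    also have "t * (- (\<beta> + \<beta>\<^sup>2 / \<gamma>) * (norm u)\<^sup>2) = - d * (norm u)\<^sup>2"
      unfolding t(2)[symmetric] by (simp add: algebra_simps)
    finally show ?thesis using qA by (simp add: quad_add quad_scaleR)
  qed
  then have "A + t *\<^sub>R B \<in> psd_cone"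
    using As B by (simp add: psd_cone_iff subspace_add[OF subspace_sym_matrices]
        subspace_scale[OF subspace_sym_matrices])
  then show False using out[OF t(1)] by simp
qed

text \<open>
  At \<open>w = t y + v\<close> the form of \<open>A + t B\<close> has no terms of order \<open>0\<close> and \<open>1\<close> in \<open>t\<close>, and its
  coefficient of \<open>t\<^sup>2\<close> is \<open>quad A y + 2 * ((B *v v) \<bullet> y)\<close>, which a suitable \<open>y\<close> makes negative
  because \<open>B *v v \<noteq> 0\<close>. As the projection has a nonnegative form, the residual must compensate.
\<close>

lemma residual_lower_bound:
  assumes A: "A \<in> psd_cone" and B: "B \<in> sym_matrices"
    and v: "A *v v = 0" "quad B v = 0" "B *v v \<noteq> 0"
  obtains c \<tau> where "c > 0" "\<tau> > 0"
    "\<And>t. 0 < t \<Longrightarrow> t \<le> \<tau> \<Longrightarrow>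
      c * t\<^sup>2 \<le> norm (closest_point psd_cone (A + t *\<^sub>R B) - (A + t *\<^sub>R B))"
proof -
  have As: "A \<in> sym_matrices" using A by (simp add: psd_cone_iff)
  obtain y where y: "quad A y + 2 * ((B *v v) \<bullet> y) < 0"
    using quad_affine_negative[of A "B *v v"] A v(3) by (auto simp: psd_cone_iff)
  define \<kappa> where "\<kappa> = - (quad A y + 2 * ((B *v v) \<bullet> y))"
  define R where "R = (norm v + norm y)\<^sup>2 + 1"
  define \<tau> where "\<tau> = min 1 (\<kappa> / (2 * (\<bar>quad B y\<bar> + 1)))"
  have \<kappa>: "\<kappa> > 0" using y by (simp add: \<kappa>_def)
  have R: "R > 0" by (simp add: R_def add_nonneg_pos)
  have \<tau>: "\<tau> > 0" using \<kappa> by (simp add: \<tau>_def add_nonneg_pos)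
  have "\<kappa> / (2 * R) * t\<^sup>2 \<le> norm (closest_point psd_cone (A + t *\<^sub>R B) - (A + t *\<^sub>R B))"
    if t: "0 < t" "t \<le> \<tau>" for t
  proof -
    define U where "U = A + t *\<^sub>R B"
    define P where "P = closest_point psd_cone U"
    define w where "w = t *\<^sub>R y + v"
    have qA: "quad A w = t\<^sup>2 * quad A y"
      using quad_add_kernel[OF As v(1)] by (simp add: w_def quad_scaleR_arg)
    have qB: "quad B w = t\<^sup>2 * quad B y + 2 * t * ((B *v v) \<bullet> y)"
      using v(2) by (simp add: w_def quad_add_arg[OF B] quad_scaleR_arg inner_commute)
    have eq: "quad U w = t\<^sup>2 * (t * quad B y - \<kappa>)"
      by (simp add: U_def quad_add quad_scaleR qA qB \<kappa>_def power2_eq_square algebra_simps)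
    have "t * quad B y \<le> t * (\<bar>quad B y\<bar> + 1)" using t by (intro mult_left_mono) auto
    also have "\<dots> \<le> \<kappa> / 2"
      using t by (simp add: \<tau>_def field_simps)
    finally have "quad U w \<le> t\<^sup>2 * (- \<kappa> / 2)"
      unfolding eq by (intro mult_left_mono) auto
    moreover have "0 \<le> quad P w"
      using psd_projection_mem[of U] by (simp add: P_def psd_cone_iff)
    moreover have "quad (P - U) w = quad P w - quad U w"
      using quad_add[of "P - U" U w] by simp
    ultimately have "t\<^sup>2 * (\<kappa> / 2) \<le> quad (P - U) w" by simp
    also have "\<dots> = outer w \<bullet> (P - U)" by (simp add: inner_outer)
    also have "\<dots> \<le> norm (outer w) * norm (P - U)" by (rule norm_cauchy_schwarz)
    also have "\<dots> \<le> R * norm (P - U)"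
    proof (rule mult_right_mono)
      have "norm w \<le> t * norm y + norm v"
        using norm_triangle_ineq[of "t *\<^sub>R y" v] t(1) by (simp add: w_def)
      also have "\<dots> \<le> norm v + norm y"
        using t by (simp add: \<tau>_def mult_left_le_one_le)
      finally have "(norm w)\<^sup>2 \<le> (norm v + norm y)\<^sup>2" by (intro power_mono) auto
      then show "norm (outer w) \<le> R" unfolding norm_outer R_def by linarith
    qed auto
    finally show ?thesis using R by (simp add: P_def U_def field_simps)
  qed
  then show thesis using that[of "\<kappa> / (2 * R)" \<tau>] \<kappa> R \<tau> by simp
qed

text \<open>
  The mixed term of \<open>t B\<close> between the kernel and its orthogonal complement is of order \<open>t\<close>; against
  the fixed coercivity of \<open>A\<close> on the complement, a shift of order \<open>t\<^sup>2\<close> on the kernel suffices to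
  absorb it. Only half of \<open>A\<close> is spent, so that the other half remains to bound \<open>N \<bullet> A\<close> in
  \<open>residual_energy_upper_bound\<close>.
\<close>

lemma half_plus_quadratic_shift_psd:
  assumes A: "A \<in> psd_cone" and B: "B \<in> sym_matrices"
    and nn: "\<And>v. A *v v = 0 \<Longrightarrow> 0 \<le> quad B v"
  obtains c \<tau> where "c > 0" "\<tau> > 0"
    "\<And>t. 0 < t \<Longrightarrow> t \<le> \<tau> \<Longrightarrow> (1/2) *\<^sub>R A + t *\<^sub>R B + (c * t\<^sup>2) *\<^sub>R mat 1 \<in> psd_cone"
proof -
  have As: "A \<in> sym_matrices" using A by (simp add: psd_cone_iff)
  obtain d where d: "d > 0"
    "\<And>u. (\<And>w. A *v w = 0 \<Longrightarrow> orthogonal u w) \<Longrightarrow> d * (norm u)\<^sup>2 \<le> quad A u"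
    using psd_coercive_off_kernel[OF A] by blast
  obtain \<beta> where \<beta>: "\<beta> > 0" "\<And>u v. \<bar>u \<bullet> (B *v v)\<bar> \<le> \<beta> * norm u * norm v"
    using bilinear_bound by blast
  (* Of the coefficient d / 2 of (norm u)^2, half pays for the form of t B at u, which explains the
     bound d / (4 beta) on t; the other half completes the square with the mixed term, which
     determines c. *)
  define c where "c = 4 * \<beta>\<^sup>2 / d"
  have c: "c > 0" using \<beta>(1) d(1) by (simp add: c_def)
  have "(1/2) *\<^sub>R A + t *\<^sub>R B + (c * t\<^sup>2) *\<^sub>R mat 1 \<in> psd_cone"
    if t: "0 < t" "t \<le> d / (4 * \<beta>)" for t
  proof -
    have "0 \<le> quad ((1/2) *\<^sub>R A + t *\<^sub>R B + (c * t\<^sup>2) *\<^sub>R mat 1) v" for v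
    proof -
      obtain u w where v: "v = u + w" and w: "A *v w = 0"
        and u: "\<And>w'. A *v w' = 0 \<Longrightarrow> orthogonal u w'"
        using kernel_decomp by blast
      have qA: "quad A v \<ge> d * (norm u)\<^sup>2"
        unfolding v quad_add_kernel[OF As w] using d(2) u by simp
      have "quad B v \<ge> - \<beta> * (norm u)\<^sup>2 - 2 * (\<beta> * norm u * norm w)"
        unfolding v quad_add_arg[OF B] using \<beta>(2)[of u u] \<beta>(2)[of u w] nn[OF w]
        by (simp add: quad_def power2_eq_square abs_le_iff)
      then have "t * quad B v \<ge> t * (- \<beta> * (norm u)\<^sup>2 - 2 * (\<beta> * norm u * norm w))"
        using t(1) by (intro mult_left_mono) auto
      moreover have "t * \<beta> * (norm u)\<^sup>2 \<le> d / 4 * (norm u)\<^sup>2"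
        using t \<beta>(1) by (intro mult_right_mono) (auto simp: field_simps)
      ultimately have qB: "t * quad B v \<ge> - d / 4 * (norm u)\<^sup>2 - 2 * t * \<beta> * norm u * norm w"
        by (simp add: algebra_simps)
      have "(norm v)\<^sup>2 = (norm u)\<^sup>2 + (norm w)\<^sup>2"
        unfolding v using u[OF w] by (rule norm_add_Pythagorean)
      then have "c * t\<^sup>2 * (norm v)\<^sup>2 \<ge> c * t\<^sup>2 * (norm w)\<^sup>2"
        using c by (intro mult_left_mono) auto
      moreover have "d / 4 * (norm u)\<^sup>2 - 2 * t * \<beta> * norm u * norm w + c * t\<^sup>2 * (norm w)\<^sup>2
        = d / 4 * (norm u - 4 * t * \<beta> * norm w / d)\<^sup>2"
        using d(1) by (simp add: c_def power2_eq_square field_simps)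
      moreover have "\<dots> \<ge> 0" using d(1) by simp
      ultimately show ?thesis
        using qA qB by (simp add: quad_add quad_scaleR quad_mat_1)
    qed
    moreover have "(1/2) *\<^sub>R A + t *\<^sub>R B + (c * t\<^sup>2) *\<^sub>R mat 1 \<in> sym_matrices"
      using As B mat_1_sym subspace_sym_matrices by (intro subspace_add subspace_scale)
    ultimately show ?thesis by (simp add: psd_cone_iff)
  qed
  then show thesis using that[of c "d / (4 * \<beta>)"] c d(1) \<beta>(1) by simp
qed

text \<open>
  Pairing the matrix of \<open>half_plus_quadratic_shift_psd\<close> with \<open>N\<close> gives
  \<open>(norm N)\<^sup>2 + (N \<bullet> A) / 2 \<le> c * t\<^sup>2 * (N \<bullet> mat 1)\<close>, whose right-hand side is linear in \<open>N\<close>. Hence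
  \<open>norm N\<close> is of order \<open>t\<^sup>2\<close>, and inserting this on the right bounds the left-hand side.
\<close>

lemma residual_energy_upper_bound:
  fixes A B :: "real^'n^'n"
  assumes A: "A \<in> psd_cone" and B: "B \<in> sym_matrices"
    and nn: "\<And>v. A *v v = 0 \<Longrightarrow> 0 \<le> quad B v"
  obtains c \<tau> where "c > 0" "\<tau> > 0"
    "\<And>t N. 0 < t \<Longrightarrow> t \<le> \<tau> \<Longrightarrow> N = closest_point psd_cone (A + t *\<^sub>R B) - (A + t *\<^sub>R B) \<Longrightarrow>
      (norm N)\<^sup>2 + N \<bullet> A \<le> c * t ^ 4"
proof -
  obtain c \<tau> where c: "c > 0" "\<tau> > 0"
    and psd: "\<And>t. 0 < t \<Longrightarrow> t \<le> \<tau> \<Longrightarrow>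
      (1/2) *\<^sub>R A + t *\<^sub>R B + (c * t\<^sup>2) *\<^sub>R mat 1 \<in> psd_cone"
    using half_plus_quadratic_shift_psd[OF A B nn] by blast
  define I where "I = norm (mat 1 :: real^'n^'n)"
  have I: "I > 0" by (auto simp: I_def vec_eq_iff mat_def)
  have "(norm N)\<^sup>2 + N \<bullet> A \<le> 2 * (c * I)\<^sup>2 * t ^ 4"
    if t: "0 < t" "t \<le> \<tau>" and N: "N = closest_point psd_cone (A + t *\<^sub>R B) - (A + t *\<^sub>R B)"
    for t N
  proof -
    have NU: "N \<bullet> (A + t *\<^sub>R B) = - (norm N)\<^sup>2"
      unfolding N by (rule psd_projection_residual_inner)
    have NA: "0 \<le> N \<bullet> A" unfolding N using A by (rule psd_projection_residual_dual)
    have "0 \<le> N \<bullet> ((1/2) *\<^sub>R A + t *\<^sub>R B + (c * t\<^sup>2) *\<^sub>R mat 1)"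
      unfolding N using psd[OF t] by (rule psd_projection_residual_dual)
    then have "(norm N)\<^sup>2 + (N \<bullet> A) / 2 \<le> c * t\<^sup>2 * (N \<bullet> mat 1)"
      using NU by (simp add: inner_add_right)
    also have "\<dots> \<le> c * t\<^sup>2 * (norm N * I)"
      unfolding I_def using c by (intro mult_left_mono norm_cauchy_schwarz) auto
    finally have le: "(norm N)\<^sup>2 + (N \<bullet> A) / 2 \<le> c * I * t\<^sup>2 * norm N"
      by (simp add: mult_ac)
    then have "norm N * norm N \<le> c * I * t\<^sup>2 * norm N"
      using NA by (simp add: power2_eq_square)
    then have "norm N \<le> c * I * t\<^sup>2"
      using c I by (cases "N = 0") auto
    then have "c * I * t\<^sup>2 * norm N \<le> c * I * t\<^sup>2 * (c * I * t\<^sup>2)"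
      using c I by (intro mult_left_mono) auto
    moreover have "2 * (c * I * t\<^sup>2 * (c * I * t\<^sup>2)) = 2 * (c * I)\<^sup>2 * t ^ 4"
      by (simp add: power2_eq_square power4_eq_xxxx)
    moreover have "(norm N)\<^sup>2 \<ge> 0" by simp
    ultimately show ?thesis using le by linarith
  qed
  then show thesis using that[of "2 * (c * I)\<^sup>2" \<tau>] c I by simp
qed

section \<open>A scalar recursion with cubic decrement\<close>

lemma inverse_square_step:
  fixes r :: real
  assumes "0 \<le> r" "r \<le> 1/2"
  shows "1 + 2 * r \<le> 1 / (1 - r)\<^sup>2" "1 / (1 - r)\<^sup>2 \<le> 1 + 6 * r"
proof -
  have pos: "(1 - r)\<^sup>2 > 0" using assms by simp
  have "(1 + 2 * r) * (1 - r)\<^sup>2 = 1 - r\<^sup>2 * (3 - 2 * r)"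
    by (simp add: power2_eq_square algebra_simps)
  also have "\<dots> \<le> 1" using assms by (simp add: mult_nonneg_nonneg)
  finally show "1 + 2 * r \<le> 1 / (1 - r)\<^sup>2" using pos by (simp add: le_divide_eq)
  have "(1 + 6 * r) * (1 - r)\<^sup>2 = 1 + r * (1 - 2 * r) * (4 - 3 * r)"
    by (simp add: power2_eq_square algebra_simps)
  also have "\<dots> \<ge> 1" using assms by (simp add: mult_nonneg_nonneg)
  finally show "1 / (1 - r)\<^sup>2 \<le> 1 + 6 * r" using pos by (simp add: divide_le_eq)
qed

text \<open>
  With \<open>r\<close> the relative decrement of a step, \<open>1 / t\<^sup>2\<close> is multiplied by \<open>1 / (1 - r)\<^sup>2\<close>, which
  \<open>inverse_square_step\<close> encloses between \<open>1 + 2 * r\<close> and \<open>1 + 6 * r\<close>. Since \<open>r\<close> is comparable to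
  \<open>t\<^sup>2\<close>, each step adds to \<open>1 / t\<^sup>2\<close> an amount between two positive constants.
\<close>

lemma cubic_decrement_bigtheta:
  fixes t :: "nat \<Rightarrow> real"
  assumes c: "c > 0" "C > 0" and \<tau>: "C * \<tau>\<^sup>2 \<le> 1/2"
    and t0: "0 < t 0" "t 0 \<le> \<tau>"
    and step: "\<And>k. 0 < t k \<Longrightarrow> t k \<le> \<tau> \<Longrightarrow>
      t k - C * t k ^ 3 \<le> t (Suc k) \<and> t (Suc k) \<le> t k - c * t k ^ 3"
  shows "t \<in> \<Theta>(\<lambda>k. real k powr (-1/2))"
proof -
  define s where "s k = 1 / (t k)\<^sup>2" for k
  have one: "0 < t (Suc k) \<and> t (Suc k) \<le> \<tau> \<and> s k + 2 * c \<le> s (Suc k) \<and> s (Suc k) \<le> s k + 6 * C"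
    if k: "0 < t k" "t k \<le> \<tau>" for k
  proof -
    define r where "r = 1 - t (Suc k) / t k"
    have tS: "t (Suc k) = t k * (1 - r)" using k by (simp add: r_def)
    have "t k * (c * (t k)\<^sup>2) \<le> t k * r" "t k * r \<le> t k * (C * (t k)\<^sup>2)"
      using step[OF k] unfolding tS by (auto simp: power2_eq_square power3_eq_cube algebra_simps)
    then have r: "c * (t k)\<^sup>2 \<le> r" "r \<le> C * (t k)\<^sup>2"
      using k(1) by simp_all
    have "C * (t k)\<^sup>2 \<le> C * \<tau>\<^sup>2"
      using k c by (intro mult_left_mono power_mono) auto
    then have r2: "0 \<le> r" "r \<le> 1/2"
      using r \<tau> c(1) zero_le_power2[of "t k"] mult_nonneg_nonneg[of c "(t k)\<^sup>2"] by linarith+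
    have sS: "s (Suc k) = s k * (1 / (1 - r)\<^sup>2)" by (simp add: s_def tS power_mult_distrib)
    have sk: "s k \<ge> 0" "s k * (t k)\<^sup>2 = 1" using k by (auto simp: s_def)
    have "s k * (1 + 2 * r) \<le> s (Suc k)" "s (Suc k) \<le> s k * (1 + 6 * r)"
      unfolding sS using inverse_square_step[OF r2] sk(1) by (intro mult_left_mono; simp)+
    moreover have "s k * (c * (t k)\<^sup>2) \<le> s k * r" "s k * r \<le> s k * (C * (t k)\<^sup>2)"
      using r sk(1) by (auto intro: mult_left_mono)
    moreover have "s k * (c * (t k)\<^sup>2) = c" "s k * (C * (t k)\<^sup>2) = C"
      using sk(2) by (metis mult.commute mult.left_commute mult.right_neutral)+
    ultimately have "s k + 2 * c \<le> s (Suc k)" "s (Suc k) \<le> s k + 6 * C"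
      by (auto simp: distrib_left mult.left_commute)
    moreover have "t k * (1 - r) \<le> t k * 1" using k r2 by (intro mult_left_mono) auto
    then have "t (Suc k) \<le> \<tau>" using k(2) unfolding tS by linarith
    ultimately show ?thesis using k r2 by (auto simp: tS)
  qed
  have range: "0 < t k \<and> t k \<le> \<tau>" for k
    by (induction k) (use t0 one in auto)
  have lo: "2 * c * real k \<le> s k" and hi: "s k \<le> s 0 + 6 * C * real k" for k
  proof (induction k)
    case (Suc k)
    { case 1 show ?case using one[of k] range[of k] Suc(1) by (simp add: algebra_simps) }
    { case 2 show ?case using one[of k] range[of k] Suc(2) by (simp add: algebra_simps) }
  qed (auto simp: s_def)
  have ts: "t k = s k powr (-1/2)" for k
  proof -
    have "s k = t k powr (-2)"
      using range[of k] by (simp add: s_def powr_minus powr_numeral divide_inverse)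
    then show ?thesis using range[of k] by (simp add: powr_powr)
  qed
  define D where "D = s 0 + 6 * C"
  have s0: "s 0 > 0" using t0 by (simp add: s_def)
  have D: "D > 0" using s0 c by (simp add: D_def)
  show ?thesis
  proof (rule bigthetaI)
    show "t \<in> O(\<lambda>k. real k powr (-1/2))"
    proof (rule bigoI[where c = "(2 * c) powr (-1/2)"])
      show "\<forall>\<^sub>F k in sequentially. norm (t k) \<le> (2 * c) powr (-1/2) * norm (real k powr (-1/2))"
        using eventually_gt_at_top[of 0]
      proof eventually_elim
        case (elim k)
        have "s k powr (-1/2) \<le> (2 * c * real k) powr (-1/2)"
          using lo[of k] c elim by (intro powr_mono2') auto
        then show ?case using c by (simp add: ts powr_mult)
      qed
    qed
    show "t \<in> \<Omega>(\<lambda>k. real k powr (-1/2))"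
    proof (rule landau_omega.bigI[where c = "D powr (-1/2)"])
      show "D powr (-1/2) > 0" using D by simp
      show "\<forall>\<^sub>F k in sequentially. norm (t k) \<ge> D powr (-1/2) * norm (real k powr (-1/2))"
        using eventually_gt_at_top[of 0]
      proof eventually_elim
        case (elim k)
        have "s 0 * 1 \<le> s 0 * real k" using s0 elim by (intro mult_left_mono) auto
        then have "s k \<le> D * real k" using hi[of k] by (simp add: D_def algebra_simps)
        moreover have "s k > 0" using range[of k] by (simp add: s_def)
        ultimately have "(D * real k) powr (-1/2) \<le> s k powr (-1/2)"
          by (intro powr_mono2') auto
        then show ?case using D by (simp add: ts powr_mult)
      qed
    qed
  qed
qed

section \<open>The convergence rate\<close>

text \<open>
  Any positive starting parameter \<open>\<tau>\<close> not exceeding the thresholds of the two residual bounds works, provided that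
  the relative decrement \<open>C * \<tau>\<^sup>2\<close> is at most one half.
\<close>

lemma alternating_projection_rate:
  fixes A B :: "real^'n^'n"
  assumes A: "A \<in> psd_cone" and B: "B \<in> sym_matrices" "B \<noteq> 0"
    and nn: "\<And>v. A *v v = 0 \<Longrightarrow> 0 \<le> quad B v"
    and out: "\<And>t. t > 0 \<Longrightarrow> A + t *\<^sub>R B \<notin> psd_cone"
    and E: "E = range (\<lambda>t. A + t *\<^sub>R B)"
  shows "\<exists>U0\<in>E. (\<lambda>k. norm (alternating_projections E U0 k - A)) \<in> \<Theta>(\<lambda>k. real k powr (-1/2))"
proof -
  obtain v where "A *v v = 0" "quad B v = 0" "B *v v \<noteq> 0"
    using degenerate_kernel_direction[OF A B(1) nn out] by blast
  then obtain c1 \<tau>1 where c1: "c1 > 0" "\<tau>1 > 0"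
    and lower: "\<And>t. 0 < t \<Longrightarrow> t \<le> \<tau>1 \<Longrightarrow>
      c1 * t\<^sup>2 \<le> norm (closest_point psd_cone (A + t *\<^sub>R B) - (A + t *\<^sub>R B))"
    using residual_lower_bound[OF A B(1)] by blast
  obtain c2 \<tau>2 where c2: "c2 > 0" "\<tau>2 > 0"
    and upper: "\<And>t N. 0 < t \<Longrightarrow> t \<le> \<tau>2 \<Longrightarrow>
      N = closest_point psd_cone (A + t *\<^sub>R B) - (A + t *\<^sub>R B) \<Longrightarrow> (norm N)\<^sup>2 + N \<bullet> A \<le> c2 * t ^ 4"
    using residual_energy_upper_bound[OF A B(1) nn] by blast
  define \<beta> where "\<beta> = (norm B)\<^sup>2"
  have \<beta>: "\<beta> > 0" using B(2) by (simp add: \<beta>_def)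
  (* One alternating projection, in terms of the parameter of the line. *)
  define g where "g t = ((closest_point psd_cone (A + t *\<^sub>R B) - A) \<bullet> B) / \<beta>" for t
  define c where "c = c1\<^sup>2 / \<beta>"
  define C where "C = c2 / \<beta>"
  have cC: "c > 0" "C > 0" using c1 c2 \<beta> by (auto simp: c_def C_def)
  define \<tau> where "\<tau> = min (min \<tau>1 \<tau>2) (sqrt (1 / (2 * C)))"
  have \<tau>: "\<tau> > 0" using c1 c2 cC by (simp add: \<tau>_def)
  have "\<tau>\<^sup>2 \<le> (sqrt (1 / (2 * C)))\<^sup>2" using \<tau> by (intro power_mono) (auto simp: \<tau>_def)
  then have C\<tau>: "C * \<tau>\<^sup>2 \<le> 1/2" using cC by (simp add: field_simps)
  have step: "t - C * t ^ 3 \<le> g t \<and> g t \<le> t - c * t ^ 3" if t: "0 < t" "t \<le> \<tau>" for t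
  proof -
    define N where "N = closest_point psd_cone (A + t *\<^sub>R B) - (A + t *\<^sub>R B)"
    have NU: "N \<bullet> (A + t *\<^sub>R B) = - (norm N)\<^sup>2"
      unfolding N_def by (rule psd_projection_residual_inner)
    have NA: "0 \<le> N \<bullet> A" unfolding N_def using A by (rule psd_projection_residual_dual)
    define f where "f = (norm N)\<^sup>2 + N \<bullet> A"
    have "closest_point psd_cone (A + t *\<^sub>R B) - A = t *\<^sub>R B + N" by (simp add: N_def)
    then have "g t = t + (N \<bullet> B) / \<beta>"
      using \<beta> by (simp add: g_def inner_add_left add_divide_distrib \<beta>_def power2_norm_eq_inner)
    moreover have "N \<bullet> B = - f / t"
      using NU t(1) by (simp add: f_def inner_add_right field_simps)
    ultimately have g: "g t = t - f / (t * \<beta>)" using t(1) \<beta> by simp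
    have "(c1 * t\<^sup>2)\<^sup>2 \<le> (norm N)\<^sup>2"
      unfolding N_def using lower[of t] t c1 by (intro power_mono) (auto simp: \<tau>_def)
    then have "c1\<^sup>2 * t ^ 4 \<le> f"
      using NA by (simp add: f_def power_mult_distrib flip: power_mult)
    then have "c1\<^sup>2 * t ^ 4 / (t * \<beta>) \<le> f / (t * \<beta>)"
      using t(1) \<beta> by (intro divide_right_mono) auto
    moreover have "f \<le> c2 * t ^ 4"
      unfolding f_def using upper[OF _ _ N_def] t by (auto simp: \<tau>_def)
    then have "f / (t * \<beta>) \<le> c2 * t ^ 4 / (t * \<beta>)"
      using t(1) \<beta> by (intro divide_right_mono) auto
    moreover have "t ^ 4 / (t * \<beta>) = t ^ 3 / \<beta>"
      using t(1) by (simp add: power4_eq_xxxx power3_eq_cube)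
    ultimately show ?thesis
      by (simp add: g c_def C_def flip: times_divide_eq_right)
  qed
  define s where "s k = (g ^^ k) \<tau>" for k
  have iter: "alternating_projections E (A + \<tau> *\<^sub>R B) k = A + s k *\<^sub>R B" for k
  proof (induction k)
    case (Suc k)
    then show ?case
      by (simp add: s_def E closest_point_line[OF B(2)] g_def \<beta>_def)
  qed (simp add: s_def)
  have "s \<in> \<Theta>(\<lambda>k. real k powr (-1/2))"
    by (rule cubic_decrement_bigtheta[OF cC C\<tau>]) (use \<tau> step in \<open>auto simp: s_def\<close>)
  then have "(\<lambda>k. norm B * norm (s k)) \<in> \<Theta>(\<lambda>k. real k powr (-1/2))"
    using B(2) by simp
  then have "(\<lambda>k. norm (alternating_projections E (A + \<tau> *\<^sub>R B) k - A)) \<in> \<Theta>(\<lambda>k. real k powr (-1/2))"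
    by (simp add: iter mult.commute)
  moreover have "A + \<tau> *\<^sub>R B \<in> E" by (auto simp: E)
  ultimately show ?thesis by blast
qed

theorem proposition5p7:
  fixes A B :: "real^'n^'n" and E :: "(real^'n^'n) set"
    and p :: nat and C :: "nat \<Rightarrow> real^'n^'n" and b :: "nat \<Rightarrow> real"
  assumes "A \<in> psd_cone - {0}"
    and "B \<in> sym_matrices - {0}"
    and "E = {A + t *\<^sub>R B | t. t \<in> (UNIV :: real set)}"
    and "psd_cone \<inter> E = {A}"
    and "\<forall>k\<in>{1..p}. C k \<in> sym_matrices"
    and "E = affine_space p C b"
    and "singularity_degree p C b > 1"
  shows "\<exists>U0\<in>E. (\<lambda>k. norm (alternating_projections E U0 k - A)) \<in> \<Theta>(\<lambda>k. real k powr (-1/2))"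
proof -
  have A: "A \<in> psd_cone" and B: "B \<in> sym_matrices" "B \<noteq> 0" using assms(1,2) by auto
  have E: "E = range (\<lambda>t. A + t *\<^sub>R B)" unfolding assms(3) by auto
  have out: "A + t *\<^sub>R B \<notin> psd_cone" if "t \<noteq> 0" for t
  proof
    assume "A + t *\<^sub>R B \<in> psd_cone"
    then have "A + t *\<^sub>R B \<in> psd_cone \<inter> E" by (auto simp: E)
    then show False using that B(2) unfolding assms(4) by simp
  qed
  have "(\<forall>v. A *v v = 0 \<longrightarrow> 0 \<le> quad B v) \<or> (\<forall>v. A *v v = 0 \<longrightarrow> quad B v \<le> 0)"
    using E assms(4,5,6,7)
    by (intro singularity_degree_gt_1_imp_semidefinite_on_kernel[OF A B(1)]) auto
  then show ?thesis
  proof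
    assume "\<forall>v. A *v v = 0 \<longrightarrow> 0 \<le> quad B v"
    then show ?thesis
      using out by (intro alternating_projection_rate[OF A B _ _ E]) auto
  next
    (* Traversing the line in the opposite direction turns this case into the previous one. *)
    assume neg: "\<forall>v. A *v v = 0 \<longrightarrow> quad B v \<le> 0"
    have quad_neg: "quad (- B) v = - quad B v" for v
      using quad_scaleR[of "-1" B v] by simp
    have "E = range (\<lambda>t. A + t *\<^sub>R (- B))"
    proof -
      have "range (\<lambda>t. A + t *\<^sub>R (- B)) = (\<lambda>t. A + t *\<^sub>R B) ` range uminus"
        by (simp only: image_image scaleR_minus_left scaleR_minus_right)
      also have "range uminus = (UNIV :: real set)" by simp
      finally show ?thesis by (simp only: E)
    qed
    moreover have "A + t *\<^sub>R (- B) \<notin> psd_cone" if "t > 0" for t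
      using out[of "- t"] that by simp
    moreover have "- B \<in> sym_matrices"
      using B(1) by (rule subspace_neg[OF subspace_sym_matrices])
    ultimately show ?thesis
      using neg B(2) quad_neg by (intro alternating_projection_rate[OF A, of "- B"]) auto
  qed
qed

end
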